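(* Let $q$ be an odd prime power, let $e\geq 2$, and let $R$ be a symplectic spread of $Sp(2e,q)$. Partition the vertices of $Sp(2e,q)$ into two parts $V_1$ and $V_2$ of equal size such that each part contains (is the union of) $(q^e+1)/2$ cliques of the spread. Let $\Gamma'_{q,e,R}$ be the graph obtained from $Sp(2e,q)$ by replacing the subgraphs induced by $V_1$ and by $V_2$ by their complements (keeping the edges between $V_1$ and $V_2$ unchanged). Then, with $v=\frac{q^{2e}-1}{q-1}$, the graph $\Gamma'_{q,e,R}$ is a divisible design graph with parameters $$(v,k,\lambda_1,\lambda_2,m,n)=\left(v,\ \frac{v}{2}-q^{e-1},\ \frac{v}{2}-q^{2e-2}-q^{e-1},\ q^{2e-2}-q^{e-1},\ 2,\ \frac{v}{2}\right).$$
   Context: A $k$-regular graph on $v$ vertices is a divisible design graph with parameters $(v,k,\lambda_1,\lambda_2,m,n)$ if its vertex set can be partitioned into $m$ classes of size $n$ such that any two distinct vertices from the same class have exactly $\lambda_1$ common neighbours and any two vertices from different classes have exactly $\lambda_2$ common neighbours. Let $\zeta$ be a symplectic polarity of $\mathrm{PG}(2e-1,q)$, i.e. a polarity with $x\in x^\zeta$ for every point $x$. The symplectic graph $Sp(2e,q)$ has the points of $\mathrm{PG}(2e-1,q)$ as vertices, two distinct points $x,y$ being adjacent iff $y\in x^\zeta$. A subspace $\pi$ is totally isotropic if $\pi\subseteq\pi^\zeta$. A symplectic spread is a set of totally isotropic subspaces of projective dimension $e-1$ partitioning the point set of $\mathrm{PG}(2e-1,q)$; it corresponds to a partition of the vertices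 of $Sp(2e,q)$ into $q^e+1$ cliques of order $(q^e-1)/(q-1)$. *)

theory Defs
  imports "HOL-Analysis.Analysis" "HOL-Library.Disjoint_Sets"
begin

section \<open>Graphs\<close>

text \<open>
  A graph is given by its vertex set and its set of edges, an edge being a set of
  two distinct vertices.
\<close>

type_synonym 'v graph = "'v set \<times> 'v set set"

definition simple_graph :: "'v graph \<Rightarrow> bool" where
  "simple_graph G \<longleftrightarrow> finite (fst G) \<and> (\<forall>f\<in>snd G. f \<subseteq> fst G \<and> card f = 2)"

definition nbrs :: "'v graph \<Rightarrow> 'v \<Rightarrow> 'v set" where
  "nbrs G x = {y \<in> fst G. {x, y} \<in> snd G}"

definition regular_graph :: "'v graph \<Rightarrow> nat \<Rightarrow> bool" where
  "regular_graph G k \<longleftrightarrow> simple_graph G \<and> (\<forall>x\<in>fst G. card (nbrs G x) = k)"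

definition divisible_design_graph ::
    "'v graph \<Rightarrow> nat \<Rightarrow> nat \<Rightarrow> nat \<Rightarrow> nat \<Rightarrow> nat \<Rightarrow> nat \<Rightarrow> bool" where
  "divisible_design_graph G v k l1 l2 m n \<longleftrightarrow>
     regular_graph G k \<and> card (fst G) = v \<and>
     (\<exists>P. partition_on (fst G) P \<and> card P = m \<and> (\<forall>C\<in>P. card C = n) \<and>
        (\<forall>C\<in>P. \<forall>x\<in>C. \<forall>y\<in>C. x \<noteq> y \<longrightarrow> card (nbrs G x \<inter> nbrs G y) = l1) \<and>
        (\<forall>C\<in>P. \<forall>D\<in>P. C \<noteq> D \<longrightarrow>
           (\<forall>x\<in>C. \<forall>y\<in>D. card (nbrs G x \<inter> nbrs G y) = l2)))"

text \<open>Replace the subgraph induced by \<open>A\<close> by its complement.\<close>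

definition complement_on :: "'v set \<Rightarrow> 'v graph \<Rightarrow> 'v graph" where
  "complement_on A G =
     (fst G, {f \<in> snd G. \<not> f \<subseteq> A} \<union> {f. f \<subseteq> A \<and> card f = 2 \<and> f \<notin> snd G})"


section \<open>Projective space and symplectic polarities\<close>

text \<open>
  The projective space PG(d - 1, q) is modelled by the lattice of linear subspaces of
  \<open>'a ^ 'n\<close>, where \<open>'a\<close> is a field with q elements and \<open>CARD('n) = d\<close>.
  A projective subspace of projective dimension i is a linear subspace of dimension
  i + 1, so a point is itself a (one-dimensional) linear subspace, and a point lies in a
  projective subspace iff it is a subset of the corresponding linear subspace.
\<close>

definition pg_points :: "('a::field ^ 'n) set set" where
  "pg_points = {p. vec.subspace p \<and> vec.dim p = 1}"

definition points_of :: "('a::field ^ 'n) set \<Rightarrow> ('a ^ 'n) set set" where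
  "points_of W = {p \<in> pg_points. p \<subseteq> W}"

text \<open>A polarity is an inclusion-reversing permutation of the subspaces that is an involution.\<close>

definition polarity :: "(('a::field ^ 'n) set \<Rightarrow> ('a ^ 'n) set) \<Rightarrow> bool" where
  "polarity \<zeta> \<longleftrightarrow>
     bij_betw \<zeta> {W. vec.subspace W} {W. vec.subspace W} \<and>
     (\<forall>U W. vec.subspace U \<longrightarrow> vec.subspace W \<longrightarrow> (U \<subseteq> W \<longleftrightarrow> \<zeta> W \<subseteq> \<zeta> U)) \<and>
     (\<forall>W. vec.subspace W \<longrightarrow> \<zeta> (\<zeta> W) = W)"

definition symplectic_polarity :: "(('a::field ^ 'n) set \<Rightarrow> ('a ^ 'n) set) \<Rightarrow> bool" where
  "symplectic_polarity \<zeta> \<longleftrightarrow> polarity \<zeta> \<and> (\<forall>p\<in>pg_points. p \<subseteq> \<zeta> p)"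

definition symplectic_graph :: "(('a::field ^ 'n) set \<Rightarrow> ('a ^ 'n) set) \<Rightarrow> ('a ^ 'n) set graph" where
  "symplectic_graph \<zeta> =
     (pg_points, {{x, y} |x y. x \<in> pg_points \<and> y \<in> pg_points \<and> x \<noteq> y \<and> y \<subseteq> \<zeta> x})"

definition totally_isotropic ::
    "(('a::field ^ 'n) set \<Rightarrow> ('a ^ 'n) set) \<Rightarrow> ('a ^ 'n) set \<Rightarrow> bool" where
  "totally_isotropic \<zeta> W \<longleftrightarrow> vec.subspace W \<and> W \<subseteq> \<zeta> W"

text \<open>Linear dimension \<open>e\<close> is projective dimension e - 1.\<close>

definition symplectic_spread ::
    "(('a::field ^ 'n) set \<Rightarrow> ('a ^ 'n) set) \<Rightarrow> nat \<Rightarrow> ('a ^ 'n) set set \<Rightarrow> bool" where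
  "symplectic_spread \<zeta> e R \<longleftrightarrow>
     (\<forall>S\<in>R. totally_isotropic \<zeta> S \<and> vec.dim S = e) \<and>
     (\<forall>S\<in>R. \<forall>T\<in>R. S \<noteq> T \<longrightarrow> points_of S \<inter> points_of T = {}) \<and>
     (\<Union>S\<in>R. points_of S) = pg_points"

text \<open>
  The union of \<open>(q ^ e + 1) / 2\<close> of the cliques of a spread; for odd \<open>q\<close> the number is an
  integer.
\<close>

definition half_spread_union ::
    "nat \<Rightarrow> nat \<Rightarrow> ('a::field ^ 'n) set set \<Rightarrow> ('a ^ 'n) set set \<Rightarrow> bool" where
  "half_spread_union q e R V \<longleftrightarrow>
     (\<exists>Q\<subseteq>R. 2 * card Q = q ^ e + 1 \<and> V = (\<Union>S\<in>Q. points_of S))"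

text \<open>The order of the two replacements is immaterial, since \<open>V1\<close> and \<open>V2\<close> are disjoint.\<close>

definition Gamma' ::
    "(('a::field ^ 'n) set \<Rightarrow> ('a ^ 'n) set) \<Rightarrow> ('a ^ 'n) set set \<Rightarrow> ('a ^ 'n) set set
      \<Rightarrow> ('a ^ 'n) set graph" where
  "Gamma' \<zeta> V1 V2 = complement_on V2 (complement_on V1 (symplectic_graph \<zeta>))"


section \<open>The parameters as natural numbers\<close>

text \<open>
  Written with division and subtraction on \<open>nat\<close>, the parameters agree with their values
  in the real numbers: both divisions are exact and no subtraction is truncated.
\<close>

lemma params_nat_exact:
  fixes q e v :: nat
  assumes q: "odd q" "q > 1" and e: "e \<ge> 2" and v: "v = (q ^ (2 * e) - 1) div (q - 1)"
  shows "real v = (real q ^ (2 * e) - 1) / (real q - 1)"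
    and "real (v div 2) = real v / 2"
    and "real (v div 2 - q ^ (e - 1)) = real v / 2 - real q ^ (e - 1)"
    and "real (v div 2 - q ^ (2 * e - 2) - q ^ (e - 1)) =
           real v / 2 - real q ^ (2 * e - 2) - real q ^ (e - 1)"
    and "real (q ^ (2 * e - 2) - q ^ (e - 1)) = real q ^ (2 * e - 2) - real q ^ (e - 1)"
proof -
  define S where "S = (\<Sum>i<2 * e. q ^ i)"
  have rS: "(real q - 1) * real S = real q ^ (2 * e) - 1"
    using power_diff_1_eq[of "real q" "2 * e"] by (simp add: S_def)
  have "real ((q - 1) * S) = real (q ^ (2 * e) - 1)"
    using rS q by (simp add: of_nat_diff)
  then have "q ^ (2 * e) - 1 = (q - 1) * S"
    by (metis of_nat_eq_iff)
  then have vS: "v = S"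
    using q v by simp
  show "real v = (real q ^ (2 * e) - 1) / (real q - 1)"
    using rS q unfolding vS by (simp add: field_simps)
  have "even (\<Sum>i<2 * k. q ^ i)" for k
    by (induction k) (use q in auto)
  then have "even v"
    unfolding vS S_def by blast
  then show half: "real (v div 2) = real v / 2"
    by (simp add: real_of_nat_div)
  have q3: "q \<ge> 3"
    using q by (cases "q = 2") auto
  obtain d where d: "e = d + 2"
    using e by (metis add.commute le_Suc_ex)
  have "(\<Sum>i\<in>{2 * e - 2, 2 * e - 1}. q ^ i) \<le> S"
    unfolding S_def by (rule sum_mono2) (use e in auto)
  then have "q ^ (2 * e - 2) + q * q ^ (2 * e - 2) \<le> S"
    unfolding d by simp
  moreover have "3 * q ^ (2 * e - 2) \<le> q * q ^ (2 * e - 2)"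
    using q3 by simp
  moreover have le: "q ^ (e - 1) \<le> q ^ (2 * e - 2)"
    by (rule power_increasing) (use q3 e in auto)
  ultimately have bd: "q ^ (2 * e - 2) + q ^ (e - 1) \<le> v div 2"
    unfolding vS by linarith
  show "real (v div 2 - q ^ (e - 1)) = real v / 2 - real q ^ (e - 1)"
    using bd half by (simp add: of_nat_diff)
  show "real (v div 2 - q ^ (2 * e - 2) - q ^ (e - 1)) =
      real v / 2 - real q ^ (2 * e - 2) - real q ^ (e - 1)"
    using bd half by (simp add: of_nat_diff)
  show "real (q ^ (2 * e - 2) - q ^ (e - 1)) = real q ^ (2 * e - 2) - real q ^ (e - 1)"
    using le by (simp add: of_nat_diff)
qed

end

theory Submission
  imports Defs
begin

text \<open>
  No alternating form is needed: a polarity reverses dimensions, so \<open>\<zeta> x\<close> is a hyperplane, a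
  spread element \<open>S\<close> satisfies \<open>\<zeta> S = S\<close>, and \<open>S \<inter> \<zeta> x\<close> is \<open>S\<close> or a hyperplane of \<open>S\<close>
  according to whether \<open>x\<close> lies in \<open>S\<close>. Hence the number of points of \<open>\<zeta> x\<close> in each part depends
  only on the part containing \<open>x\<close>, while \<open>\<zeta> x \<inter> \<zeta> y\<close> always has codimension 2. For \<open>x\<close> in \<open>V1\<close>
  the new neighbourhood is \<open>(V1 - \<zeta> x) \<union> (V2 \<inter> \<zeta> x)\<close>, and in the inclusion-exclusion counts of
  common neighbours the two unknown pieces \<open>V1 \<inter> \<zeta> x \<inter> \<zeta> y\<close> and \<open>V2 \<inter> \<zeta> x \<inter> \<zeta> y\<close> occur only
  through their sum, which is known.
\<close>

section \<open>Subspaces over a finite field\<close>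

text \<open>Adjoining \<open>a\<close> to \<open>B\<close> multiplies the size of the span by the
  size of the field, because \<open>(k, y)\<close> and \<open>k *s a + y\<close> correspond
  bijectively.\<close>

lemma card_span_independent:
  fixes B :: "('a::{field,finite} ^ 'n::finite) set"
  assumes "vec.independent B"
  shows "card (vec.span B) = CARD('a) ^ card B"
  using finite_class.finite[of B] assms
proof (induction B rule: finite_induct)
  case empty
  then show ?case by simp
next
  case (insert a B)
  let ?f = "\<lambda>(k, y). k *s a + y"
  have a: "a \<notin> vec.span B" and B: "vec.independent B"
    using insert by (auto simp: vec.independent_insert split: if_splits)
  have "vec.span (insert a B) = ?f ` (UNIV \<times> vec.span B)" (is "?L = ?R")
  proof
    show "?L \<subseteq> ?R"
    proof
      fix x assume "x \<in> ?L"
      then obtain k where "x - k *s a \<in> vec.span B"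
        by (auto simp: vec.span_breakdown_eq)
      moreover have "x = ?f (k, x - k *s a)" by simp
      ultimately show "x \<in> ?R" by blast
    qed
    show "?R \<subseteq> ?L"
      by (auto intro!: vec.span_add vec.span_scale vec.span_base[of a]
        intro: subsetD[OF vec.span_mono[OF subset_insertI]])
  qed
  moreover have "inj_on ?f (UNIV \<times> vec.span B)"
  proof (rule inj_onI, clarify)
    fix k y l z
    assume yz: "y \<in> vec.span B" "z \<in> vec.span B" and eq: "k *s a + y = l *s a + z"
    have "(k - l) *s a = z - y" using eq by (simp add: vec.scale_left_diff_distrib algebra_simps)
    then have "(k - l) *s a \<in> vec.span B" using yz by (simp add: vec.span_diff)
    \<comment> \<open>If \<open>k\<close> and \<open>l\<close> differed, dividing by
      \<open>k - l\<close> would put \<open>a\<close> itself into the span of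
      \<open>B\<close>.\<close>
    then have "inverse (k - l) *s ((k - l) *s a) \<in> vec.span B" by (rule vec.span_scale)
    then have "(inverse (k - l) * (k - l)) *s a \<in> vec.span B" by (simp only: vec.scale_scale)
    with a have "k = l" by (metis left_inverse right_minus_eq vec.scale_one)
    with eq show "k = l \<and> y = z" by simp
  qed
  ultimately show ?case using insert B by (simp add: card_image card_cartesian_product)
qed

lemma card_subspace:
  fixes W :: "('a::{field,finite} ^ 'n::finite) set"
  assumes "vec.subspace W"
  shows "card W = CARD('a) ^ vec.dim W"
proof -
  obtain B where "B \<subseteq> W" "vec.independent B" "W \<subseteq> vec.span B" "card B = vec.dim W"
    using vec.basis_exists by blast
  then show ?thesis
    using card_span_independent assms by (metis vec.span_subspace)
qed

lemma card_field_gt_1: "1 < CARD('a::{field,finite})"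
proof -
  have "card {0, 1 :: 'a} \<le> CARD('a)" by (rule card_mono) auto
  then show ?thesis by simp
qed

lemma pg_points_eq_of_common_vector:
  assumes p: "p \<in> pg_points" and r: "r \<in> pg_points" and w: "w \<in> p" "w \<in> r" "w \<noteq> 0"
  shows "p = r"
proof -
  have *: "vec.span {w} = s" if "s \<in> pg_points" "w \<in> s" for s
    using that w(3) vec.subspace_dim_equal[of "vec.span {w}" s]
    by (auto simp: pg_points_def vec.span_minimal vec.dim_singleton)
  show ?thesis using * p r w by metis
qed

text \<open>The nonzero vectors of \<open>W\<close> are partitioned by its points, each of which
  carries q - 1 of them. The geometric sum stands for the usual quotient and keeps later arithmetic
  free of division.\<close>

lemma card_points_of:
  fixes W :: "('a::{field,finite} ^ 'n::finite) set"
  assumes W: "vec.subspace W"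
  shows "card (points_of W) = (\<Sum>i<vec.dim W. CARD('a) ^ i)"
proof -
  let ?q = "CARD('a)"
  have un: "W - {0} = (\<Union>p\<in>points_of W. p - {0})"
  proof
    show "W - {0} \<subseteq> (\<Union>p\<in>points_of W. p - {0})"
    proof
      fix w assume w: "w \<in> W - {0}"
      then have "vec.span {w} \<in> points_of W"
        using W by (auto simp: points_of_def pg_points_def vec.dim_singleton vec.span_minimal)
      moreover have "w \<in> vec.span {w} - {0}" using w by (simp add: vec.span_base)
      ultimately show "w \<in> (\<Union>p\<in>points_of W. p - {0})" by blast
    qed
  qed (auto simp: points_of_def)
  have c: "card (p - {0}) = ?q - 1" if "p \<in> points_of W" for p
    using that card_subspace[of p] vec.subspace_0[of p]
    by (simp add: points_of_def pg_points_def card_Diff_singleton)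
  have "card (W - {0}) = (\<Sum>p\<in>points_of W. card (p - {0}))"
    unfolding un by (rule card_UN_disjoint)
      (auto simp: points_of_def dest: pg_points_eq_of_common_vector)
  then have "?q ^ vec.dim W - 1 = card (points_of W) * (?q - 1)"
    using c card_subspace[OF W] vec.subspace_0[OF W] by (simp add: card_Diff_singleton)
  \<comment> \<open>Checked over the integers, where subtraction is not truncated.\<close>
  moreover have "?q ^ vec.dim W - 1 = (?q - 1) * (\<Sum>i<vec.dim W. ?q ^ i)"
  proof -
    have "1 \<le> ?q" "1 \<le> ?q ^ vec.dim W" using card_field_gt_1[where 'a='a] by auto
    then show ?thesis
      using power_diff_1_eq[of "int ?q" "vec.dim W"]
      by (simp add: of_nat_diff flip: of_nat_eq_iff[where 'a=int])
  qed
  ultimately show ?thesis using card_field_gt_1[where 'a='a] by simp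
qed

text \<open>The sum \<open>T\<close> of \<open>W\<close> and \<open>H\<close> properly contains
  \<open>H\<close>, so it has full dimension, and the dimension formula for sums and intersections
  gives the rest.\<close>

lemma dim_Int_hyperplane:
  fixes H W :: "('a::field ^ 'n::finite) set"
  assumes H: "vec.subspace H" "Suc (vec.dim H) = CARD('n)" and W: "vec.subspace W"
    and nsub: "\<not> W \<subseteq> H"
  shows "Suc (vec.dim (W \<inter> H)) = vec.dim W"
proof -
  define T where "T = {x + y |x y. x \<in> W \<and> y \<in> H}"
  have sub: "vec.subspace T" unfolding T_def using W H(1) by (rule vec.subspace_sums)
  have "W \<subseteq> T" unfolding T_def using vec.subspace_0[OF H(1)] by force
  moreover have "H \<subseteq> T" unfolding T_def using vec.subspace_0[OF W] by force
  ultimately have "H \<subset> T" using nsub by blast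
  then have "vec.dim H < vec.dim T"
    using vec.dim_psubset[of H T]
    by (simp only: vec.span_eq_iff[THEN iffD2, OF H(1)] vec.span_eq_iff[THEN iffD2, OF sub])
  moreover have "vec.dim T \<le> CARD('n)" by (rule dim_subset_UNIV_cart_gen)
  moreover have "vec.dim T + vec.dim (W \<inter> H) = vec.dim W + vec.dim H"
    unfolding T_def using W H(1) by (rule vec.dim_sums_Int)
  ultimately show ?thesis using H(2) by simp
qed

text \<open>Used twice in the theorem: with equal lengths it factors a sum of even length, and with
  first length 1 it relates a geometric sum to its last power.\<close>

lemma sum_power_add:
  fixes q :: "'a::comm_semiring_1"
  shows "(\<Sum>i<d + m. q ^ i) = (\<Sum>i<d. q ^ i) + q ^ d * (\<Sum>i<m. q ^ i)"
  by (induction m) (simp_all add: algebra_simps power_add)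


section \<open>Polarities\<close>

lemma polarity_subspace:
  assumes "polarity \<zeta>" "vec.subspace W"
  shows "vec.subspace (\<zeta> W)"
  using assms by (auto simp: polarity_def dest: bij_betwE)

lemma polarity_psubset:
  assumes "polarity \<zeta>" "vec.subspace U" "vec.subspace W" "U \<subset> W"
  shows "\<zeta> W \<subset> \<zeta> U"
  using assms unfolding polarity_def less_le_not_le psubset_eq by metis

lemma dim_polarity_psubset:
  fixes U W :: "('a::field ^ 'n::finite) set"
  assumes "polarity \<zeta>" "vec.subspace U" "vec.subspace W" "U \<subset> W"
  shows "vec.dim (\<zeta> W) < vec.dim (\<zeta> U)"
  using polarity_psubset[OF assms] polarity_subspace[OF assms(1)] assms(2,3)
  by (metis vec.dim_psubset vec.span_eq_iff)

text \<open>Adjoining basis vectors one by one gives a strictly increasing chain of spans. Their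
  polars strictly decrease, so each vector costs at least one dimension, starting from at most
  \<open>CARD('n)\<close>.\<close>

lemma dim_polarity_le:
  fixes B :: "('a::field ^ 'n::finite) set"
  assumes pol: "polarity \<zeta>" and "finite B" "vec.independent B"
  shows "vec.dim (\<zeta> (vec.span B)) + card B \<le> CARD('n)"
  using assms(2,3)
proof (induction B rule: finite_induct)
  case empty
  then show ?case by (simp add: dim_subset_UNIV_cart_gen)
next
  case (insert a B)
  have a: "a \<notin> vec.span B" and B: "vec.independent B"
    using insert by (auto simp: vec.independent_insert split: if_splits)
  have "vec.span B \<subset> vec.span (insert a B)"
    using a by (metis insertI1 psubsetI subset_insertI vec.span_base vec.span_mono)
  then have "vec.dim (\<zeta> (vec.span (insert a B))) < vec.dim (\<zeta> (vec.span B))"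
    by (intro dim_polarity_psubset[OF pol]) auto
  then show ?case using insert B by simp
qed

text \<open>The opposite bound climbs from \<open>W\<close> to the whole space, one dimension at a
  time. The polar loses dimension at every step, so it must have had at least the codimension of
  \<open>W\<close> to begin with.\<close>

lemma dim_polarity_ge:
  fixes W :: "('a::field ^ 'n::finite) set"
  assumes pol: "polarity \<zeta>" and "vec.subspace W"
  shows "CARD('n) \<le> vec.dim (\<zeta> W) + vec.dim W"
  using assms(2)
proof (induction "CARD('n) - vec.dim W" arbitrary: W rule: less_induct)
  case less
  show ?case
  proof (cases "CARD('n) \<le> vec.dim W")
    case False
    then obtain a where a: "a \<notin> W"
      by (metis UNIV_eq_I order_refl vec_dim_card)
    let ?W = "vec.span (insert a W)"
    have d: "vec.dim ?W = Suc (vec.dim W)"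
      using a less.prems by (simp add: vec.dim_insert vec.span_eq_iff[THEN iffD2])
    have "W \<subset> ?W"
      using a by (metis insert_subset psubsetI vec.span_superset)
    then have "vec.dim (\<zeta> ?W) < vec.dim (\<zeta> W)"
      using less.prems by (intro dim_polarity_psubset[OF pol]) auto
    moreover have "CARD('n) \<le> vec.dim (\<zeta> ?W) + vec.dim ?W"
      using False d by (intro less.hyps) auto
    ultimately show ?thesis using d by simp
  qed simp
qed

lemma dim_polarity:
  fixes W :: "('a::field ^ 'n::finite) set"
  assumes pol: "polarity \<zeta>" and W: "vec.subspace W"
  shows "vec.dim (\<zeta> W) + vec.dim W = CARD('n)"
proof -
  obtain B where "B \<subseteq> W" "vec.independent B" "W \<subseteq> vec.span B" "card B = vec.dim W"
    using vec.basis_exists by blast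
  moreover from this have "vec.span B = W" using W by (metis vec.span_subspace)
  ultimately show ?thesis
    using dim_polarity_le[OF pol, of B] dim_polarity_ge[OF pol W] vec.finiteI_independent by fastforce
qed

text \<open>Order reversal is applied to \<open>U\<close> and \<open>\<zeta> W\<close>, and the
  involution removes the double polar. This is what makes adjacency symmetric.\<close>

lemma polarity_conjugate_sym:
  assumes "polarity \<zeta>" "vec.subspace U" "vec.subspace W"
  shows "U \<subseteq> \<zeta> W \<longleftrightarrow> W \<subseteq> \<zeta> U"
proof -
  have "U \<subseteq> \<zeta> W \<longleftrightarrow> \<zeta> (\<zeta> W) \<subseteq> \<zeta> U"
    using assms(1,2) polarity_subspace[OF assms(1,3)] unfolding polarity_def by blast
  then show ?thesis using assms(1,3) by (simp add: polarity_def)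
qed

lemma polarity_totally_isotropic_eq:
  fixes W :: "('a::field ^ 'n::finite) set"
  assumes pol: "polarity \<zeta>" and W: "totally_isotropic \<zeta> W" "2 * vec.dim W = CARD('n)"
  shows "\<zeta> W = W"
proof -
  have s: "vec.subspace W" "W \<subseteq> \<zeta> W" using W(1) by (auto simp: totally_isotropic_def)
  then have "W = \<zeta> W"
    using dim_polarity[OF pol s(1)] W(2) polarity_subspace[OF pol s(1)]
    by (intro vec.subspace_dim_equal) auto
  then show ?thesis by simp
qed

lemma card_points_of_polar_Int:
  fixes x y :: "('a::{field,finite} ^ 'n::finite) set"
  assumes pol: "polarity \<zeta>" and xy: "x \<in> pg_points" "y \<in> pg_points" "x \<noteq> y"
  shows "card (points_of (\<zeta> x) \<inter> points_of (\<zeta> y)) = (\<Sum>i<CARD('n) - 2. CARD('a) ^ i)"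
proof -
  have s: "vec.subspace x" "vec.subspace y" and d: "vec.dim x = 1" "vec.dim y = 1"
    using xy by (auto simp: pg_points_def)
  note sz = s[THEN polarity_subspace[OF pol]]
  \<comment> \<open>Points have equal dimension, so distinct ones are incomparable. Reversal carries
    this over to their polar hyperplanes.\<close>
  have "\<not> x \<subseteq> y" using vec.subspace_dim_equal[OF s] d xy(3) by auto
  then have "\<not> \<zeta> y \<subseteq> \<zeta> x" using pol s by (simp add: polarity_def)
  then have "Suc (vec.dim (\<zeta> y \<inter> \<zeta> x)) = vec.dim (\<zeta> y)"
    using dim_polarity[OF pol s(1)] d sz by (intro dim_Int_hyperplane) auto
  then have "vec.dim (\<zeta> y \<inter> \<zeta> x) = CARD('n) - 2"
    using dim_polarity[OF pol s(2)] d by simp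
  moreover have "points_of (\<zeta> x) \<inter> points_of (\<zeta> y) = points_of (\<zeta> y \<inter> \<zeta> x)"
    by (auto simp: points_of_def)
  ultimately show ?thesis
    using card_points_of[OF vec.subspace_inter[OF sz(2,1)]] by simp
qed


section \<open>Spreads\<close>

lemma card_spread_union:
  fixes R :: "('a::{field,finite} ^ 'n::finite) set set"
  assumes "symplectic_spread \<zeta> e R" "Q \<subseteq> R"
  shows "card (\<Union>S\<in>Q. points_of S) = card Q * (\<Sum>i<e. CARD('a) ^ i)"
proof -
  have S: "vec.subspace S \<and> vec.dim S = e" if "S \<in> Q" for S
    using assms(1) subsetD[OF assms(2) that]
    by (simp add: symplectic_spread_def totally_isotropic_def)
  have disj: "\<forall>S\<in>Q. \<forall>T\<in>Q. S \<noteq> T \<longrightarrow> points_of S \<inter> points_of T = {}"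
  proof (intro ballI impI)
    fix S T assume "S \<in> Q" "T \<in> Q" "S \<noteq> T"
    moreover from this have "S \<in> R" "T \<in> R" using assms(2) by auto
    ultimately show "points_of S \<inter> points_of T = {}"
      using assms(1) unfolding symplectic_spread_def by metis
  qed
  have "card (\<Union>S\<in>Q. points_of S) = (\<Sum>S\<in>Q. card (points_of S))"
    by (rule card_UN_disjoint) (simp_all add: disj)
  also have "\<dots> = (\<Sum>S\<in>Q. \<Sum>i<e. CARD('a) ^ i)"
    using S by (simp add: card_points_of)
  finally show ?thesis by simp
qed

text \<open>Each member of \<open>Q\<close> meets \<open>\<zeta> x\<close> at least in a hyperplane
  of itself, of linear dimension \<open>d\<close>. A member through \<open>x\<close> lies entirely
  in \<open>\<zeta> x\<close> and contributes \<open>CARD('a) ^ d\<close> further points;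
  \<open>?g\<close> records this excess.\<close>

lemma card_spread_union_Int_polar:
  fixes R :: "('a::{field,finite} ^ 'n::finite) set set"
  assumes n: "CARD('n) = 2 * Suc d" and pol: "polarity \<zeta>"
    and spread: "symplectic_spread \<zeta> (Suc d) R" and Q: "Q \<subseteq> R" and x: "x \<in> pg_points"
  defines "V \<equiv> \<Union>S\<in>Q. points_of S"
  shows "card (V \<inter> points_of (\<zeta> x)) =
    card Q * (\<Sum>i<d. CARD('a) ^ i) + (if x \<in> V then CARD('a) ^ d else 0)"
proof -
  let ?g = "\<lambda>S. if x \<in> points_of S then CARD('a) ^ d else 0"
  have sx: "vec.subspace x" and dx: "vec.dim x = 1" using x by (auto simp: pg_points_def)
  have S: "vec.subspace S" "vec.dim S = Suc d" "\<zeta> S = S" if "S \<in> Q" for S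
  proof -
    have "S \<in> R" using that Q by blast
    then show "vec.subspace S" "vec.dim S = Suc d" "\<zeta> S = S"
      using spread n polarity_totally_isotropic_eq[OF pol, of S]
      by (auto simp: symplectic_spread_def totally_isotropic_def)
  qed
  have c: "card (points_of S \<inter> points_of (\<zeta> x)) = (\<Sum>i<d. CARD('a) ^ i) + ?g S"
    if "S \<in> Q" for S
  proof (cases "x \<in> points_of S")
    case True
    then have "S \<subseteq> \<zeta> x"
      using polarity_conjugate_sym[OF pol S(1)[OF that] sx] S(3)[OF that]
      by (simp add: points_of_def)
    then have "points_of S \<inter> points_of (\<zeta> x) = points_of S" by (auto simp: points_of_def)
    then show ?thesis using True S[OF that] by (simp add: card_points_of)
  next
    case False
    \<comment> \<open>Otherwise conjugacy would give \<open>x \<subseteq> \<zeta> S\<close>, and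
      \<open>\<zeta> S = S\<close> would put \<open>x\<close> in \<open>S\<close>.\<close>
    then have "\<not> S \<subseteq> \<zeta> x"
      using polarity_conjugate_sym[OF pol S(1)[OF that] sx] S(3)[OF that] x
      by (simp add: points_of_def)
    then have "Suc (vec.dim (S \<inter> \<zeta> x)) = vec.dim S"
      using S[OF that] dim_polarity[OF pol sx] dx polarity_subspace[OF pol sx]
      by (intro dim_Int_hyperplane) auto
    moreover have "points_of S \<inter> points_of (\<zeta> x) = points_of (S \<inter> \<zeta> x)"
      by (auto simp: points_of_def)
    ultimately show ?thesis
      using False S[OF that] card_points_of[OF vec.subspace_inter, of S "\<zeta> x"]
        polarity_subspace[OF pol sx] by simp
  qed
  have disj: "S = T" if "S \<in> Q" "T \<in> Q" "z \<in> points_of S" "z \<in> points_of T" for S T z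
  proof (rule ccontr)
    assume "S \<noteq> T"
    moreover have "S \<in> R" "T \<in> R" using that Q by auto
    ultimately have "points_of S \<inter> points_of T = {}"
      using spread unfolding symplectic_spread_def by metis
    then show False using that by blast
  qed
  \<comment> \<open>Spread members share no point, so at most one term of the sum is
    nonzero.\<close>
  have g: "(\<Sum>S\<in>Q. ?g S) = (if x \<in> V then CARD('a) ^ d else 0)"
  proof (cases "x \<in> V")
    case True
    then obtain S where S': "S \<in> Q" "x \<in> points_of S" by (auto simp: V_def)
    have "(\<Sum>T\<in>Q. ?g T) = (\<Sum>T\<in>{S}. ?g T)"
      using S' disj by (intro sum.mono_neutral_right) auto
    then show ?thesis using S' True by simp
  qed (auto simp: V_def intro!: sum.neutral)
  have "V \<inter> points_of (\<zeta> x) = (\<Union>S\<in>Q. points_of S \<inter> points_of (\<zeta> x))"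
    by (auto simp: V_def)
  also have "card \<dots> = (\<Sum>S\<in>Q. card (points_of S \<inter> points_of (\<zeta> x)))"
    using disj by (intro card_UN_disjoint) auto
  also have "\<dots> = (\<Sum>S\<in>Q. (\<Sum>i<d. CARD('a) ^ i) + ?g S)"
    using c by simp
  finally show ?thesis using g by (simp add: sum.distrib)
qed


section \<open>Neighbourhoods after partial complementation\<close>

lemma symplectic_graph_edge_iff:
  assumes "polarity \<zeta>"
  shows "{x, y} \<in> snd (symplectic_graph \<zeta>) \<longleftrightarrow>
    x \<in> pg_points \<and> y \<in> pg_points \<and> x \<noteq> y \<and> y \<in> points_of (\<zeta> x)"
proof -
  have "x \<subseteq> \<zeta> y \<longleftrightarrow> y \<subseteq> \<zeta> x" if "x \<in> pg_points" "y \<in> pg_points"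
    using that polarity_conjugate_sym[OF assms] by (simp add: pg_points_def)
  then show ?thesis
    by (auto simp: symplectic_graph_def points_of_def doubleton_eq_iff)
qed

lemma simple_symplectic_graph:
  fixes \<zeta> :: "('a::{field,finite} ^ 'n::finite) set \<Rightarrow> ('a ^ 'n) set"
  shows "simple_graph (symplectic_graph \<zeta>)"
  by (auto simp: simple_graph_def symplectic_graph_def card_2_iff)

lemma simple_complement_on:
  assumes "simple_graph G" "A \<subseteq> fst G"
  shows "simple_graph (complement_on A G)"
  using assms by (auto simp: simple_graph_def complement_on_def)

text \<open>No pair of vertices lies in both \<open>A\<close> and \<open>B\<close>, so the two
  replacements alter disjoint sets of pairs. This allows the two parts to exchange roles.\<close>

lemma complement_on_commute:
  assumes "A \<inter> B = {}"
  shows "complement_on B (complement_on A G) = complement_on A (complement_on B G)"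
proof -
  have "\<not> (f \<subseteq> A \<and> f \<subseteq> B \<and> card f = 2)" for f
    using assms by (metis card.empty le_inf_iff subset_empty zero_neq_numeral)
  then show ?thesis
    unfolding complement_on_def fst_conv snd_conv prod.inject by blast
qed

text \<open>Since \<open>x \<in> \<zeta> x\<close>, removing the polar of \<open>x\<close> also removes the loop at \<open>x\<close>.\<close>

lemma nbrs_Gamma':
  assumes \<zeta>: "symplectic_polarity \<zeta>" and V: "V1 \<union> V2 = pg_points" "V1 \<inter> V2 = {}"
    and x: "x \<in> V1"
  shows "nbrs (Gamma' \<zeta> V1 V2) x = (V1 - points_of (\<zeta> x)) \<union> (V2 \<inter> points_of (\<zeta> x))"
    and "nbrs (Gamma' \<zeta> V2 V1) x = (V1 - points_of (\<zeta> x)) \<union> (V2 \<inter> points_of (\<zeta> x))"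
proof -
  have pol: "polarity \<zeta>" using \<zeta> by (simp add: symplectic_polarity_def)
  have xx: "x \<in> points_of (\<zeta> x)" and xP: "x \<in> pg_points"
    using x V \<zeta> by (auto simp: symplectic_polarity_def points_of_def)
  have c: "card {x, y} = 2 \<longleftrightarrow> x \<noteq> y" for y by (simp add: card_insert_if)
  have "{x, y} \<in> snd (Gamma' \<zeta> V1 V2) \<longleftrightarrow>
      y \<in> (V1 - points_of (\<zeta> x)) \<union> (V2 \<inter> points_of (\<zeta> x))" if "y \<in> pg_points" for y
    using x V that xx xP
    by (auto simp: Gamma'_def complement_on_def symplectic_graph_edge_iff[OF pol] c)
  moreover have "fst (Gamma' \<zeta> V1 V2) = pg_points"
    by (simp add: Gamma'_def complement_on_def symplectic_graph_def)
  ultimately show 1: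
    "nbrs (Gamma' \<zeta> V1 V2) x = (V1 - points_of (\<zeta> x)) \<union> (V2 \<inter> points_of (\<zeta> x))"
    using V(1) unfolding nbrs_def by blast
  show "nbrs (Gamma' \<zeta> V2 V1) x = (V1 - points_of (\<zeta> x)) \<union> (V2 \<inter> points_of (\<zeta> x))"
    using 1 complement_on_commute[OF V(2)] by (metis Gamma'_def)
qed

section \<open>Cardinalities of switched sets and of their intersections\<close>

lemma card_switched:
  assumes "finite A" "finite B" "A \<inter> B = {}"
  shows "card ((A - H) \<union> (B \<inter> H)) + card (A \<inter> H) = card A + card (B \<inter> H)"
proof -
  have "card ((A - H) \<union> (B \<inter> H)) = card (A - H) + card (B \<inter> H)"
    using assms by (intro card_Un_disjoint) auto
  moreover have "card A = card (A \<inter> H) + card (A - H)"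
    using assms by (metis card_Un_disjoint finite_Diff finite_Int Int_Diff_disjoint Int_Diff_Un)
  ultimately show ?thesis by simp
qed

text \<open>The intersection is \<open>A\<close> outside \<open>H \<union> K\<close> together with
  \<open>B\<close> inside \<open>H \<inter> K\<close>. Inclusion-exclusion on \<open>A\<close>
  produces \<open>A \<inter> (H \<inter> K)\<close>, which merges with the piece in
  \<open>B\<close>. The equation is additive to avoid truncated subtraction.\<close>

lemma card_switched_Int_same:
  assumes "finite A" "finite B" "A \<inter> B = {}"
  shows "card (((A - H) \<union> (B \<inter> H)) \<inter> ((A - K) \<union> (B \<inter> K))) + card (A \<inter> H) + card (A \<inter> K)
    = card A + card ((A \<union> B) \<inter> (H \<inter> K))"
proof -
  have "((A - H) \<union> (B \<inter> H)) \<inter> ((A - K) \<union> (B \<inter> K)) = (A - (H \<union> K)) \<union> (B \<inter> (H \<inter> K))"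
    using assms by auto
  also have "card \<dots> = card (A - (H \<union> K)) + card (B \<inter> (H \<inter> K))"
    using assms by (intro card_Un_disjoint) auto
  finally have 1: "card (((A - H) \<union> (B \<inter> H)) \<inter> ((A - K) \<union> (B \<inter> K))) = \<dots>" .
  have 2: "card A = card (A \<inter> (H \<union> K)) + card (A - (H \<union> K))"
    using assms by (metis card_Un_disjoint finite_Diff finite_Int Int_Diff_disjoint Int_Diff_Un)
  have 3: "card (A \<inter> H) + card (A \<inter> K) = card (A \<inter> (H \<union> K)) + card (A \<inter> (H \<inter> K))"
    using card_Un_Int[of "A \<inter> H" "A \<inter> K"] assms by (simp add: Int_Un_distrib Int_ac)
  have "card ((A \<union> B) \<inter> (H \<inter> K)) = card (A \<inter> (H \<inter> K)) + card (B \<inter> (H \<inter> K))"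
    unfolding Int_Un_distrib2 using assms by (intro card_Un_disjoint) auto
  with 1 2 3 show ?thesis by simp
qed

text \<open>For vertices in different parts the intersection is crosswise:
  \<open>A \<inter> K\<close> without \<open>H\<close>, and \<open>B \<inter> H\<close> without
  \<open>K\<close>. The two removed pieces again make up
  \<open>(A \<union> B) \<inter> (H \<inter> K)\<close>.\<close>

lemma card_switched_Int_diff:
  assumes "finite A" "finite B" "A \<inter> B = {}"
  shows "card (((A - H) \<union> (B \<inter> H)) \<inter> ((B - K) \<union> (A \<inter> K))) + card ((A \<union> B) \<inter> (H \<inter> K))
    = card (A \<inter> K) + card (B \<inter> H)"
proof -
  have "((A - H) \<union> (B \<inter> H)) \<inter> ((B - K) \<union> (A \<inter> K)) = (A \<inter> K - H) \<union> (B \<inter> H - K)"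
    using assms by auto
  also have "card \<dots> = card (A \<inter> K - H) + card (B \<inter> H - K)"
    using assms by (intro card_Un_disjoint) auto
  finally have 1: "card (((A - H) \<union> (B \<inter> H)) \<inter> ((B - K) \<union> (A \<inter> K))) = \<dots>" .
  have 2: "card C = card (C \<inter> L) + card (C - L)" if "finite C" for C L :: "'a set"
    using that by (metis card_Un_disjoint finite_Diff finite_Int Int_Diff_disjoint Int_Diff_Un)
  have "card ((A \<union> B) \<inter> (H \<inter> K)) = card (A \<inter> K \<inter> H) + card (B \<inter> H \<inter> K)"
  proof -
    have "(A \<union> B) \<inter> (H \<inter> K) = (A \<inter> K \<inter> H) \<union> (B \<inter> H \<inter> K)" by auto
    then show ?thesis using assms by (simp add: card_Un_disjoint disjoint_iff)
  qed
  with 1 2[of "A \<inter> K" H] 2[of "B \<inter> H" K] assms show ?thesis by simp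
qed

theorem theorem7:
  fixes \<zeta> :: "('a::{field,finite} ^ 'n::finite) set \<Rightarrow> ('a ^ 'n) set"
    and R V1 V2 :: "('a ^ 'n) set set"
    and q e v :: nat
  assumes "CARD('a) = q" and "odd q"
    and "e \<ge> 2" and "CARD('n) = 2 * e"
    and "symplectic_polarity \<zeta>"
    and "symplectic_spread \<zeta> e R"
    and "V1 \<union> V2 = fst (symplectic_graph \<zeta>)" and "V1 \<inter> V2 = {}" and "card V1 = card V2"
    and "half_spread_union q e R V1" and "half_spread_union q e R V2"
    and "v = (q ^ (2 * e) - 1) div (q - 1)"
  shows "divisible_design_graph (Gamma' \<zeta> V1 V2)
           v
           (v div 2 - q ^ (e - 1))
           (v div 2 - q ^ (2 * e - 2) - q ^ (e - 1))
           (q ^ (2 * e - 2) - q ^ (e - 1))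
           2
           (v div 2)"
proof -
  obtain d where e: "e = Suc d" using assms(3) by (cases e) auto
  have q: "1 < q" using card_field_gt_1[where 'a='a] assms(1) by simp
  have pol: "polarity \<zeta>" using assms(5) by (simp add: symplectic_polarity_def)
  have P: "V1 \<union> V2 = pg_points" using assms(7) by (simp add: symplectic_graph_def)
  \<comment> \<open>\<open>t\<close> counts the points of a hyperplane of a spread member,
    \<open>s\<close> is the excess contributed by the member through a given point, and
    \<open>n\<close> will be the size of each part.\<close>
  define t s n where "t = (\<Sum>i<d. q ^ i)" and "s = q ^ d" and "n = v div 2"
  have ts: "(\<Sum>i<e. q ^ i) = t + s" by (simp add: e t_def s_def)
  have t2: "(\<Sum>i<2 * e - 2. q ^ i) = t * (s + 1)"
    using sum_power_add[of q d d] by (simp add: e t_def s_def mult_2)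
  \<comment> \<open>Both sides are the sum of the powers of \<open>q\<close> up to
    \<open>q ^ d\<close>, with the first or the last term split off. Multiplied by \<open>s\<close>,
    this becomes \<open>qts\<close>, which eliminates \<open>q\<close> from the counts.\<close>
  have qs: "q * t + 1 = s + t"
    using sum_power_add[of q 1 d] by (simp add: t_def s_def)
  have qts: "q * s * t + s = s * s + s * t"
  proof -
    have "q * s * t + s = s * (q * t + 1)" by (simp add: algebra_simps)
    also have "\<dots> = s * s + s * t" unfolding qs by (rule distrib_left)
    finally show ?thesis .
  qed
  obtain Q1 Q2 where Q: "Q1 \<subseteq> R" "Q2 \<subseteq> R" "2 * card Q1 = q * s + 1" "2 * card Q2 = q * s + 1"
    and VQ: "V1 = (\<Union>S\<in>Q1. points_of S)" "V2 = (\<Union>S\<in>Q2. points_of S)"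
    using assms(10,11) by (auto simp: half_spread_union_def e s_def)
  define h where "h = card Q1"
  have h: "2 * h = q * s + 1" "card Q2 = h" using Q by (simp_all add: h_def)
  have cV: "card V1 = h * (t + s)" "card V2 = h * (t + s)"
    using card_spread_union[OF assms(6) Q(1)] card_spread_union[OF assms(6) Q(2)] h ts
    by (simp_all add: VQ assms(1) h_def)
  have cP: "card (pg_points :: ('a ^ 'n) set set) = 2 * (h * (t + s))"
    using cV assms(8) by (simp flip: P add: card_Un_disjoint)
  have "card (pg_points :: ('a ^ 'n) set set) = (\<Sum>i<2 * e. q ^ i)"
    using card_points_of[of "UNIV :: ('a ^ 'n) set"] assms(1,4)
    by (simp add: points_of_def vec_dim_card del: vec.dim_UNIV)
  moreover have "v = (\<Sum>i<2 * e. q ^ i)"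
  proof -
    have "(q - 1) * (\<Sum>i<2 * e. q ^ i) = q ^ (2 * e) - 1"
      using q power_diff_1_eq[of "int q" "2 * e"]
      by (simp add: of_nat_diff flip: of_nat_eq_iff[where 'a=int])
    then show ?thesis using q assms(12) by (metis nonzero_mult_div_cancel_left zero_less_diff less_not_refl)
  qed
  ultimately have "v = 2 * (h * (t + s))" using cP by simp
  then have v: "v = 2 * n" "n = h * (t + s)" unfolding n_def by simp_all

  let ?G = "Gamma' \<zeta> V1 V2"
  \<comment> \<open>\<open>A\<close> is the part containing \<open>x\<close> and \<open>B\<close> is
    the other one, so each count is done once for both parts. The subtracted terms stand on the
    left, so the parameters follow without truncation.\<close>
  have main: "card (nbrs ?G x) + s = n"
      "\<And>y. y \<in> A \<Longrightarrow> x \<noteq> y \<Longrightarrow> card (nbrs ?G x \<inter> nbrs ?G y) + s * s + s = n"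
      "\<And>y. y \<in> B \<Longrightarrow> card (nbrs ?G x \<inter> nbrs ?G y) + s = s * s"
    if AB: "(A = V1 \<and> B = V2) \<or> (A = V2 \<and> B = V1)" and x: "x \<in> A" for A B x
  proof -
    have disj: "A \<inter> B = {}" and un: "A \<union> B = pg_points" using AB assms(8) P by auto
    have cA: "card A = n" using AB cV v by auto
    have nA: "nbrs ?G z = (A - points_of (\<zeta> z)) \<union> (B \<inter> points_of (\<zeta> z))" if "z \<in> A" for z
      using AB nbrs_Gamma'[OF assms(5) un disj that] by auto
    have nB: "nbrs ?G z = (B - points_of (\<zeta> z)) \<union> (A \<inter> points_of (\<zeta> z))" if "z \<in> B" for z
      using AB nbrs_Gamma'[OF assms(5) _ _ that, of A] un disj by (auto simp: Un_commute Int_commute)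
    have cnt: "card (V \<inter> points_of (\<zeta> z)) = h * t + (if z \<in> V then s else 0)"
      if "z \<in> pg_points" "V = A \<or> V = B" for V z
    proof -
      have "V = V1 \<or> V = V2" using that AB by auto
      then show ?thesis
        using card_spread_union_Int_polar[OF assms(4)[unfolded e] pol assms(6)[unfolded e] _ that(1)]
          Q(1,2) h assms(1) by (auto simp: VQ t_def s_def h_def)
    qed
    have common: "card ((A \<union> B) \<inter> (points_of (\<zeta> x) \<inter> points_of (\<zeta> y))) = t * (s + 1)"
      if "y \<in> pg_points" "x \<noteq> y" for y
    proof -
      have "(A \<union> B) \<inter> (points_of (\<zeta> x) \<inter> points_of (\<zeta> y)) = points_of (\<zeta> x) \<inter> points_of (\<zeta> y)"
        using un by (auto simp: points_of_def)
      then show ?thesis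
        using card_points_of_polar_Int[OF pol _ that] x un assms(1,4) t2 by auto
    qed
    have xP: "x \<in> pg_points" "x \<notin> B" using x un disj by auto
    \<comment> \<open>Two polar counts over the parts always contribute \<open>2 * (h * t)\<close>;
      rewriting it in \<open>q\<close>, \<open>s\<close> and \<open>t\<close> lets
      \<open>qts\<close> cancel every \<open>t\<close> against \<open>t * (s + 1)\<close> from
      \<open>common\<close>.\<close>
    have ht: "2 * (h * t) = q * s * t + t"
    proof -
      have "2 * (h * t) = (2 * h) * t" by simp
      also have "\<dots> = q * s * t + t" unfolding h(1) by (simp add: distrib_right)
      finally show ?thesis .
    qed
    show "card (nbrs ?G x) + s = n"
      using card_switched[of A B "points_of (\<zeta> x)"] disj cnt[OF xP(1)] x xP nA[OF x] cA by simp
    show "card (nbrs ?G x \<inter> nbrs ?G y) + s * s + s = n" if y: "y \<in> A" "x \<noteq> y" for y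
    proof -
      have "y \<in> pg_points" using y un by auto
      then show ?thesis
        using card_switched_Int_same[of A B "points_of (\<zeta> x)" "points_of (\<zeta> y)"] disj
          cnt[of x A] cnt[of y A] x y xP nA[OF x] nA[OF y(1)] cA common[of y] ht qts
        by (simp add: algebra_simps)
    qed
    show "card (nbrs ?G x \<inter> nbrs ?G y) + s = s * s" if y: "y \<in> B" for y
    proof -
      have "y \<in> pg_points" "y \<notin> A" "x \<noteq> y" using y un disj xP by auto
      then show ?thesis
        using card_switched_Int_diff[of A B "points_of (\<zeta> x)" "points_of (\<zeta> y)"] disj
          cnt[of x B] cnt[of y A] y xP nA[OF x] nB[OF y(1)] common[of y] ht qts
        by (simp add: algebra_simps)
    qed
  qed
  note main1 = main[of V1 V2] and main2 = main[of V2 V1]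
  have fG: "fst ?G = pg_points"
    by (simp add: Gamma'_def complement_on_def symplectic_graph_def)
  have simple: "simple_graph ?G"
    unfolding Gamma'_def using assms(7)
    by (intro simple_complement_on simple_symplectic_graph) (auto simp: complement_on_def)
  have pows: "q ^ (e - 1) = s" "q ^ (2 * e - 2) = s * s"
    by (simp_all add: e s_def mult_2 power_add)
  \<comment> \<open>Positivity makes the parts nonempty, as a partition requires; being disjoint as
    well, they are two distinct classes.\<close>
  have n0: "n > 0"
  proof -
    have "h > 0" using h by (cases h) auto
    moreover have "s > 0" using q by (simp add: s_def)
    ultimately show ?thesis by (simp add: v)
  qed
  have ne: "V1 \<noteq> {}" "V2 \<noteq> {}" using cV v n0 by auto
  have "regular_graph ?G (n - s)"
    unfolding regular_graph_def fG using simple main1(1) main2(1) by (fastforce simp flip: P)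
  moreover have "partition_on pg_points {V1, V2}"
    using P ne assms(8) by (auto simp: partition_on_def disjoint_def)
  moreover have "card {V1, V2} = 2" using assms(8) ne by (auto simp: card_insert_if)
  moreover have "\<forall>C\<in>{V1, V2}. card C = n" using cV v by simp
  moreover have "\<forall>C\<in>{V1, V2}. \<forall>x\<in>C. \<forall>y\<in>C. x \<noteq> y \<longrightarrow>
      card (nbrs ?G x \<inter> nbrs ?G y) = n - s * s - s"
    using main1(2) main2(2) by fastforce
  moreover have "\<forall>C\<in>{V1, V2}. \<forall>D\<in>{V1, V2}. C \<noteq> D \<longrightarrow>
      (\<forall>x\<in>C. \<forall>y\<in>D. card (nbrs ?G x \<inter> nbrs ?G y) = s * s - s)"
    using main1(3) main2(3) by fastforce
  ultimately show ?thesis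
    unfolding divisible_design_graph_def fG pows n_def[symmetric] using cP v by blast
qed

end
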